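(* Let $G=(V,E,w)$ be a connected hypergraph with $V=\{v_1,\dots,v_{n+m}\}$ and let $p\in[1,\infty)$. There exists a constant $\gamma$ depending only on $p$ and $G$ such that the following holds. Let $T\in(0,\infty)$ and, for $k=1,2$, let $a^k=(0,\dots,0,a^k_1,\dots,a^k_m)\in W^{1,2}(0,T;\mathbb{R}^V)$ (first $n$ components zero), $h^k\in L^2(0,T;\mathbb{R}^V)$, $x_0^k\in K_{a^k}(0)$, and let $x^k\in W^{1,2}(0,T;\mathbb{R}^V)$ be the solution to $$(x^k)'(t)+\partial\varphi(x^k(t))+\partial I_{K_{a^k}(t)}(x^k(t))\ni h^k(t)\quad(t\in[0,T]),\qquad x^k(0)=x^k_0 .$$ Then $$\sup_{0\le t\le T}\Big(\sum_{i=1}^n|x^1_i(t)-x^2_i(t)|^2\Big)^{1/2}\le\Big(\sum_{i=1}^n|x^1_{0i}-x^2_{0i}|^2\Big)^{1/2}+\int_0^T\|h^1(t)-h^2(t)\|\,dt$$ $$\qquad+\gamma\Big(\sup_{0\le t\le T}\|x^1(t)\|^{\frac{p-1}{2}}+\sup_{0\le t\le T}\|x^2(t)\|^{\frac{p-1}{2}}\Big)\Big(\int_0^T\|a^1(t)-a^2(t)\|\,dt\Big)^{1/2}.$$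
   Context: Hypergraph: $n,m\ge 1$ are integers, $V=\{v_1,\dots,v_n,v_{n+1},\dots,v_{n+m}\}$ is a finite set with $n+m$ elements, $E\subset 2^V$ is a family of subsets of $V$ each having at least two elements, and $w:E\to(0,\infty)$. The triplet $G=(V,E,w)$ is called a hypergraph. $G$ is connected if for all $u,v\in V$ there exist $u_1,\dots,u_{N-1}\in V$ and $e_1,\dots,e_N\in E$ with $u_{j-1},u_j\in e_j$ for $j=1,\dots,N$, where $u_0=u$, $u_N=v$. $\mathbb{R}^V$ is the set of maps $x:V\to\mathbb{R}$, identified with $\mathbb{R}^{n+m}$ via $x_i=x(v_i)$, with standard inner product $x\cdot y$ and Euclidean norm $\|x\|$. The components of $x^k(t)$ and $x^k_0$ are denoted $x^k_i(t)$ and $x^k_{0i}$. Energy: $f_e(x)=\max_{u,v\in e}(x(u)-x(v))$ for $e\in E$, and $\varphi(x)=\frac1p\sum_{e\in E}w(e)(f_e(x))^p$. Subdifferential: for a proper lower semicontinuous convex $\psi:\mathbb{R}^V\to(-\infty,+\infty]$, $\partial\psi(x)=\{\eta\in\mathbb{R}^V:\ \eta\cdot(z-x)\le\psi(z)-\psi(x)\ \forall z\in\mathbb{R}^V\}$ if $\psi(x)<\infty$, and $\partial\psi(x)=\varnothing$ otherwise. Constraint: for $a=(0,\dots,0,a_1,\dots,a_m)$, $K_a(t)=\{x\in\mathbb{R}^V:\ x=(x_1,\dots,x_n,a_1(t),\dots,a_m(t)),\ x_i\in\mathbb{R}\ (i=1,\dots,n)\}$, and $I_{K_a(t)}$ is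 its indicator function ($0$ on $K_a(t)$, $+\infty$ elsewhere). $W^{1,2}(0,T;\mathbb{R}^V)$ is the set of functions that belong to $L^2(0,T;\mathbb{R}^V)$ together with their derivative; its elements are identified with their (absolutely) continuous representatives on $[0,T]$. A solution of $x'+\partial\varphi(x)+\partial I_{K_a(t)}(x)\ni h$, $x(0)=x_0$, is a function $x\in W^{1,2}(0,T;\mathbb{R}^V)$ with $x(0)=x_0$ for which the inclusion holds for a.e. $t\in[0,T]$, i.e. there are $\eta(t)\in\partial\varphi(x(t))$ and $\xi(t)\in\partial I_{K_a(t)}(x(t))$ with $x'(t)+\eta(t)+\xi(t)=h(t)$ for a.e. $t$. (Such a solution exists and is unique for the data considered.) When $p=1$, the powers $\|\cdot\|^{(p-1)/2}$ are read as $1$. *)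

theory Defs
  imports "HOL-Analysis.Analysis"
begin

section \<open>Hypergraphs\<close>

text \<open>The vertex set is the whole (finite) type.  In the evolution problem below it is a sum type
  \<open>'n + 'm\<close>: \<open>Inl i\<close> are the \<open>n = CARD('n)\<close> free vertices \<open>v\<^sub>1, \<dots>, v\<^sub>n\<close>, and \<open>Inr j\<close> are the
  \<open>m = CARD('m)\<close> vertices \<open>v\<^sub>n\<^sub>+\<^sub>1, \<dots>, v\<^sub>n\<^sub>+\<^sub>m\<close> on which the state is prescribed.  Types are
  nonempty, so \<open>n, m \<ge> 1\<close>.  Values of the weight outside of \<open>E\<close> are never used.\<close>

definition hypergraph :: "'v::finite set set \<Rightarrow> ('v set \<Rightarrow> real) \<Rightarrow> bool" where
  "hypergraph E w \<longleftrightarrow> (\<forall>e\<in>E. 2 \<le> card e) \<and> (\<forall>e\<in>E. 0 < w e)"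

definition hypergraph_connected :: "'v::finite set set \<Rightarrow> bool" where
  "hypergraph_connected E \<longleftrightarrow>
     (\<forall>u v. \<exists>N\<ge>1. \<exists>(y :: nat \<Rightarrow> 'v) (e :: nat \<Rightarrow> 'v set). y 0 = u \<and> y N = v \<and>
        (\<forall>j\<in>{1..N}. e j \<in> E \<and> y (j - 1) \<in> e j \<and> y j \<in> e j))"

definition edge_osc :: "'v::finite set \<Rightarrow> real ^ 'v \<Rightarrow> real" where
  "edge_osc e x = Max ((\<lambda>(u, v). x $ u - x $ v) ` (e \<times> e))"

definition energy :: "real \<Rightarrow> 'v::finite set set \<Rightarrow> ('v set \<Rightarrow> real) \<Rightarrow> real ^ 'v \<Rightarrow> real" where
  "energy p E w x = 1 / p * (\<Sum>e\<in>E. w e * edge_osc e x powr p)"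


section \<open>Subdifferentials and the constraint\<close>

definition subdifferential :: "('a::real_inner \<Rightarrow> ereal) \<Rightarrow> 'a \<Rightarrow> 'a set" where
  "subdifferential \<psi> x =
     (if \<psi> x < \<infinity> then {\<eta>. \<forall>z. ereal (\<eta> \<bullet> (z - x)) \<le> \<psi> z - \<psi> x} else {})"

definition convex_indicator :: "'a set \<Rightarrow> 'a \<Rightarrow> ereal" where
  "convex_indicator K x = (if x \<in> K then 0 else \<infinity>)"

text \<open>The set \<open>K\<^sub>a(t)\<close>, in terms of the vector \<open>b = a(t)\<close>; only the components \<open>Inr j\<close> of \<open>b\<close>
  matter.\<close>

definition constraint_set :: "real ^ ('n::finite + 'm::finite) \<Rightarrow> (real ^ ('n + 'm)) set" where
  "constraint_set b = {x. \<forall>j. x $ Inr j = b $ Inr j}"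


section \<open>Function spaces on the interval from 0 to T\<close>

definition square_integrable_on :: "real \<Rightarrow> (real \<Rightarrow> 'a::euclidean_space) \<Rightarrow> bool" where
  "square_integrable_on T h \<longleftrightarrow> h \<in> borel_measurable (lebesgue_on {0..T}) \<and>
     integrable (lebesgue_on {0..T}) (\<lambda>t. (norm (h t))\<^sup>2)"

definition abs_continuous_on :: "real \<Rightarrow> real \<Rightarrow> (real \<Rightarrow> 'a::real_normed_vector) \<Rightarrow> bool" where
  "abs_continuous_on a b f \<longleftrightarrow>
     (\<forall>\<epsilon>>0. \<exists>\<delta>>0. \<forall>(N :: nat) l r.
        (\<forall>i<N. a \<le> l i \<and> l i \<le> r i \<and> r i \<le> b) \<longrightarrow>
        disjoint_family_on (\<lambda>i. {l i<..<r i}) {..<N} \<longrightarrow>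
        (\<Sum>i<N. r i - l i) < \<delta> \<longrightarrow>
        (\<Sum>i<N. norm (f (r i) - f (l i))) < \<epsilon>)"

text \<open>Elements of \<open>W\<^sup>1\<^sup>,\<^sup>2\<close> are represented by their absolutely continuous representatives on
  \<open>[0, T]\<close>, whose weak derivative is the derivative that exists almost everywhere.\<close>

definition W12 :: "real \<Rightarrow> (real \<Rightarrow> 'a::euclidean_space) \<Rightarrow> bool" where
  "W12 T f \<longleftrightarrow> abs_continuous_on 0 T f \<and> square_integrable_on T f \<and>
     (\<exists>f'. square_integrable_on T f' \<and>
        (AE t in lebesgue_on {0..T}. (f has_vector_derivative f' t) (at t)))"


section \<open>The evolution problem\<close>

definition is_solution ::
  "real \<Rightarrow> ('n::finite + 'm::finite) set set \<Rightarrow> (('n + 'm) set \<Rightarrow> real) \<Rightarrow> real \<Rightarrow>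
   (real \<Rightarrow> real ^ ('n + 'm)) \<Rightarrow> (real \<Rightarrow> real ^ ('n + 'm)) \<Rightarrow> real ^ ('n + 'm) \<Rightarrow>
   (real \<Rightarrow> real ^ ('n + 'm)) \<Rightarrow> bool" where
  "is_solution p E w T a h x0 x \<longleftrightarrow> W12 T x \<and> x 0 = x0 \<and>
     (AE t in lebesgue_on {0..T}.
        \<exists>x' \<eta> \<xi>. (x has_vector_derivative x') (at t) \<and>
          \<eta> \<in> subdifferential (\<lambda>y. ereal (energy p E w y)) (x t) \<and>
          \<xi> \<in> subdifferential (convex_indicator (constraint_set (a t))) (x t) \<and>
          x' + \<eta> + \<xi> = h t)"

definition admissible_boundary :: "real \<Rightarrow> (real \<Rightarrow> real ^ ('n::finite + 'm::finite)) \<Rightarrow> bool" where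
  "admissible_boundary T a \<longleftrightarrow> W12 T a \<and> (\<forall>t\<in>{0..T}. \<forall>i. a t $ Inl i = 0)"

text \<open>The power \<open>\<parallel>x\<parallel>\<close> to the \<open>(p - 1) / 2\<close>, which is 1 for \<open>p = 1\<close> (whereas \<open>0 powr 0 = 0\<close>).\<close>

definition norm_pow :: "real \<Rightarrow> 'a::real_normed_vector \<Rightarrow> real" where
  "norm_pow p x = (if p = 1 then 1 else norm x powr ((p - 1) / 2))"

end

theory Submission
  imports Defs
begin

text \<open>The proof is an energy estimate for the free part \<open>\<zeta>\<close> of \<open>x\<^sup>1 - x\<^sup>2\<close>.  The full difference is
  \<open>\<zeta> + (a\<^sup>1 - a\<^sup>2)\<close>, and the constraint forces \<open>\<xi>\<^sup>k\<close> have no free part, so for almost every \<open>t\<close>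
  \<open>1/2 (d/dt) \<parallel>\<zeta>\<parallel>\<^sup>2 = \<zeta> \<bullet> (h\<^sup>1 - h\<^sup>2) - (x\<^sup>1 - x\<^sup>2) \<bullet> (\<eta>\<^sup>1 - \<eta>\<^sup>2) + (a\<^sup>1 - a\<^sup>2) \<bullet> (\<eta>\<^sup>1 - \<eta>\<^sup>2)\<close>.
  The second term is nonpositive by monotonicity of \<open>\<partial>\<phi>\<close>, which leaves
  \<open>\<parallel>\<zeta>\<parallel> \<parallel>h\<^sup>1 - h\<^sup>2\<parallel> + \<parallel>a\<^sup>1 - a\<^sup>2\<parallel> (\<parallel>\<eta>\<^sup>1\<parallel> + \<parallel>\<eta>\<^sup>2\<parallel>)\<close> (lemma \<open>free_part_dissipation\<close>).

  Subgradients of \<open>\<phi>\<close> grow like the power \<open>p - 1\<close>: \<open>\<parallel>\<eta>\<parallel> \<le> C \<parallel>x\<parallel>\<^sup>p\<^sup>-\<^sup>1\<close> with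
  \<open>C = 2\<^sup>p \<Sum>\<^sub>e w(e)\<close> (lemma \<open>energy_subgradient_le\<close>).  With \<open>M\<close> the sum of the two suprema of
  \<open>\<parallel>x\<^sup>k\<parallel>\<close> to the power \<open>(p - 1)/2\<close>, the last term is therefore at most \<open>C M\<^sup>2 \<parallel>a\<^sup>1 - a\<^sup>2\<parallel>\<close>.  A
  Gronwall-type inequality without loss of constants (lemma \<open>norm_le_of_energy_inequality\<close>) then gives
  the claim with \<open>\<gamma> = (2C)\<^sup>1\<^sup>/\<^sup>2\<close>.  It rests on the fundamental theorem of calculus for absolutely
  continuous functions that are differentiable almost everywhere
  (\<open>fundamental_theorem_of_calculus_abs_continuous\<close>).\<close>

section \<open>Absolutely continuous functions\<close>

text \<open>The family of intervals may be indexed by any finite set, such as a tagged division.\<close>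

lemma abs_continuous_on_finite_family:
  assumes "abs_continuous_on a b f" and "0 < \<epsilon>"
  shows "\<exists>\<delta>>0. \<forall>(I :: 'i set) l r. finite I \<longrightarrow>
    (\<forall>i\<in>I. a \<le> l i \<and> l i \<le> r i \<and> r i \<le> b) \<longrightarrow>
    disjoint_family_on (\<lambda>i. {l i<..<r i}) I \<longrightarrow> (\<Sum>i\<in>I. r i - l i) < \<delta> \<longrightarrow>
    (\<Sum>i\<in>I. norm (f (r i) - f (l i))) < \<epsilon>"
proof -
  obtain \<delta> where "\<delta> > 0" and \<delta>: "\<And>(N :: nat) l r. \<lbrakk>\<forall>i<N. a \<le> l i \<and> l i \<le> r i \<and> r i \<le> b;
        disjoint_family_on (\<lambda>i. {l i<..<r i}) {..<N}; (\<Sum>i<N. r i - l i) < \<delta>\<rbrakk>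
       \<Longrightarrow> (\<Sum>i<N. norm (f (r i) - f (l i))) < \<epsilon>"
    using assms unfolding abs_continuous_on_def by blast
  show ?thesis
  proof (intro exI[of _ \<delta>] conjI allI impI)
    fix I :: "'i set" and l r
    assume "finite I" and lr: "\<forall>i\<in>I. a \<le> l i \<and> l i \<le> r i \<and> r i \<le> b"
      and disj: "disjoint_family_on (\<lambda>i. {l i<..<r i}) I" and sum: "(\<Sum>i\<in>I. r i - l i) < \<delta>"
    obtain k where k: "bij_betw k {..<card I} I"
      using ex_bij_betw_nat_finite[OF \<open>finite I\<close>] by (auto simp: atLeast0LessThan)
    have "(\<Sum>i<card I. norm (f (r (k i)) - f (l (k i)))) < \<epsilon>"
    proof (rule \<delta>)
      show "\<forall>i<card I. a \<le> l (k i) \<and> l (k i) \<le> r (k i) \<and> r (k i) \<le> b"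
        using lr k by (auto simp: bij_betw_def)
      show "disjoint_family_on (\<lambda>i. {l (k i)<..<r (k i)}) {..<card I}"
        using disj k unfolding disjoint_family_on_def bij_betw_def inj_on_def by blast
      show "(\<Sum>i<card I. r (k i) - l (k i)) < \<delta>"
        using sum sum.reindex_bij_betw[OF k, of "\<lambda>i. r i - l i"] by simp
    qed
    then show "(\<Sum>i\<in>I. norm (f (r i) - f (l i))) < \<epsilon>"
      using sum.reindex_bij_betw[OF k, of "\<lambda>i. norm (f (r i) - f (l i))"] by simp
  qed (fact \<open>\<delta> > 0\<close>)
qed

lemma abs_continuous_on_dominated:
  assumes "abs_continuous_on a b f" and "abs_continuous_on a b g"
    and dom: "\<And>s t. \<lbrakk>s \<in> {a..b}; t \<in> {a..b}\<rbrakk>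
                \<Longrightarrow> norm (F t - F s) \<le> norm (f t - f s) + norm (g t - g s)"
  shows "abs_continuous_on a b F"
  unfolding abs_continuous_on_def
proof (intro allI impI)
  fix \<epsilon> :: real assume "0 < \<epsilon>"
  then have "0 < \<epsilon> / 2" by simp
  obtain \<delta>f where "\<delta>f > 0" and \<delta>f: "\<And>(N :: nat) l r. \<lbrakk>\<forall>i<N. a \<le> l i \<and> l i \<le> r i \<and> r i \<le> b;
        disjoint_family_on (\<lambda>i. {l i<..<r i}) {..<N}; (\<Sum>i<N. r i - l i) < \<delta>f\<rbrakk>
       \<Longrightarrow> (\<Sum>i<N. norm (f (r i) - f (l i))) < \<epsilon> / 2"
    using assms(1) \<open>0 < \<epsilon> / 2\<close> unfolding abs_continuous_on_def by blast
  obtain \<delta>g where "\<delta>g > 0" and \<delta>g: "\<And>(N :: nat) l r. \<lbrakk>\<forall>i<N. a \<le> l i \<and> l i \<le> r i \<and> r i \<le> b;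
        disjoint_family_on (\<lambda>i. {l i<..<r i}) {..<N}; (\<Sum>i<N. r i - l i) < \<delta>g\<rbrakk>
       \<Longrightarrow> (\<Sum>i<N. norm (g (r i) - g (l i))) < \<epsilon> / 2"
    using assms(2) \<open>0 < \<epsilon> / 2\<close> unfolding abs_continuous_on_def by blast
  show "\<exists>\<delta>>0. \<forall>(N :: nat) l r. (\<forall>i<N. a \<le> l i \<and> l i \<le> r i \<and> r i \<le> b) \<longrightarrow>
        disjoint_family_on (\<lambda>i. {l i<..<r i}) {..<N} \<longrightarrow>
        (\<Sum>i<N. r i - l i) < \<delta> \<longrightarrow> (\<Sum>i<N. norm (F (r i) - F (l i))) < \<epsilon>"
  proof (intro exI[of _ "min \<delta>f \<delta>g"] conjI allI impI)
    show "0 < min \<delta>f \<delta>g" using \<open>\<delta>f > 0\<close> \<open>\<delta>g > 0\<close> by simp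
    fix N :: nat and l r
    assume lr: "\<forall>i<N. a \<le> l i \<and> l i \<le> r i \<and> r i \<le> b"
      and disj: "disjoint_family_on (\<lambda>i. {l i<..<r i}) {..<N}"
      and sum: "(\<Sum>i<N. r i - l i) < min \<delta>f \<delta>g"
    have "(\<Sum>i<N. norm (F (r i) - F (l i)))
          \<le> (\<Sum>i<N. norm (f (r i) - f (l i)) + norm (g (r i) - g (l i)))"
    proof (rule sum_mono)
      fix i assume "i \<in> {..<N}"
      with lr have "a \<le> l i" "l i \<le> r i" "r i \<le> b" by auto
      then show "norm (F (r i) - F (l i)) \<le> norm (f (r i) - f (l i)) + norm (g (r i) - g (l i))"
        by (intro dom) auto
    qed
    also have "\<dots> = (\<Sum>i<N. norm (f (r i) - f (l i))) + (\<Sum>i<N. norm (g (r i) - g (l i)))"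
      by (rule sum.distrib)
    also have "\<dots> < \<epsilon> / 2 + \<epsilon> / 2"
      using \<delta>f[OF lr disj] \<delta>g[OF lr disj] sum by (intro add_strict_mono) auto
    finally show "(\<Sum>i<N. norm (F (r i) - F (l i))) < \<epsilon>" by simp
  qed
qed

lemma lipschitz_imp_abs_continuous_on:
  assumes lip: "K-lipschitz_on {a..b} f"
  shows "abs_continuous_on a b f"
  unfolding abs_continuous_on_def
proof (intro allI impI)
  fix \<epsilon> :: real assume "0 < \<epsilon>"
  have "0 \<le> K" using lip by (rule lipschitz_on_nonneg)
  show "\<exists>\<delta>>0. \<forall>(N :: nat) l r. (\<forall>i<N. a \<le> l i \<and> l i \<le> r i \<and> r i \<le> b) \<longrightarrow>
        disjoint_family_on (\<lambda>i. {l i<..<r i}) {..<N} \<longrightarrow>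
        (\<Sum>i<N. r i - l i) < \<delta> \<longrightarrow> (\<Sum>i<N. norm (f (r i) - f (l i))) < \<epsilon>"
  proof (intro exI[of _ "\<epsilon> / (K + 1)"] conjI allI impI)
    show "0 < \<epsilon> / (K + 1)" using \<open>0 < \<epsilon>\<close> \<open>0 \<le> K\<close> by simp
    fix N :: nat and l r
    assume lr: "\<forall>i<N. a \<le> l i \<and> l i \<le> r i \<and> r i \<le> b"
      and sum: "(\<Sum>i<N. r i - l i) < \<epsilon> / (K + 1)"
    have "(\<Sum>i<N. norm (f (r i) - f (l i))) \<le> (\<Sum>i<N. (K + 1) * (r i - l i))"
    proof (rule sum_mono)
      fix i assume "i \<in> {..<N}"
      with lr have "a \<le> l i" "l i \<le> r i" "r i \<le> b" by auto
      then have "norm (f (r i) - f (l i)) \<le> K * (r i - l i)"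
        using lipschitz_onD[OF lip, of "r i" "l i"] by (simp add: dist_norm)
      then show "norm (f (r i) - f (l i)) \<le> (K + 1) * (r i - l i)"
        using \<open>l i \<le> r i\<close> by (simp add: algebra_simps)
    qed
    also have "\<dots> = (K + 1) * (\<Sum>i<N. r i - l i)" by (simp add: sum_distrib_left)
    also have "\<dots> < \<epsilon>" using sum \<open>0 \<le> K\<close> by (simp add: field_simps)
    finally show "(\<Sum>i<N. norm (f (r i) - f (l i))) < \<epsilon>" .
  qed
qed

lemma abs_continuous_on_imp_continuous_on:
  assumes "abs_continuous_on a b f"
  shows "continuous_on {a..b} f"
  unfolding continuous_on_iff
proof (intro ballI allI impI)
  fix t \<epsilon> :: real assume t: "t \<in> {a..b}" and "0 < \<epsilon>"
  obtain \<delta> where "\<delta> > 0" and \<delta>: "\<And>(I :: unit set) l r. \<lbrakk>finite I;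
        \<forall>i\<in>I. a \<le> l i \<and> l i \<le> r i \<and> r i \<le> b;
        disjoint_family_on (\<lambda>i. {l i<..<r i}) I; (\<Sum>i\<in>I. r i - l i) < \<delta>\<rbrakk>
       \<Longrightarrow> (\<Sum>i\<in>I. norm (f (r i) - f (l i))) < \<epsilon>"
    using abs_continuous_on_finite_family[OF assms \<open>0 < \<epsilon>\<close>] by blast
  show "\<exists>d>0. \<forall>s\<in>{a..b}. dist s t < d \<longrightarrow> dist (f s) (f t) < \<epsilon>"
  proof (intro exI[of _ \<delta>] conjI ballI impI)
    fix s assume s: "s \<in> {a..b}" "dist s t < \<delta>"
    have "(\<Sum>i\<in>{()}. norm (f (max s t) - f (min s t))) < \<epsilon>"
      using s t by (intro \<delta>) (auto simp: disjoint_family_on_def dist_real_def)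
    then show "dist (f s) (f t) < \<epsilon>"
      by (simp add: dist_norm norm_minus_commute max_def min_def split: if_splits)
  qed (fact \<open>\<delta> > 0\<close>)
qed

lemma abs_continuous_on_subinterval:
  assumes "abs_continuous_on a b f" and "b' \<le> b"
  shows "abs_continuous_on a b' f"
  unfolding abs_continuous_on_def
proof (intro allI impI)
  fix \<epsilon> :: real assume "0 < \<epsilon>"
  then obtain \<delta> where "\<delta> > 0" and \<delta>: "\<And>(N :: nat) l r. \<lbrakk>\<forall>i<N. a \<le> l i \<and> l i \<le> r i \<and> r i \<le> b;
        disjoint_family_on (\<lambda>i. {l i<..<r i}) {..<N}; (\<Sum>i<N. r i - l i) < \<delta>\<rbrakk>
       \<Longrightarrow> (\<Sum>i<N. norm (f (r i) - f (l i))) < \<epsilon>"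
    using assms(1) unfolding abs_continuous_on_def by blast
  show "\<exists>\<delta>>0. \<forall>(N :: nat) l r. (\<forall>i<N. a \<le> l i \<and> l i \<le> r i \<and> r i \<le> b') \<longrightarrow>
        disjoint_family_on (\<lambda>i. {l i<..<r i}) {..<N} \<longrightarrow>
        (\<Sum>i<N. r i - l i) < \<delta> \<longrightarrow> (\<Sum>i<N. norm (f (r i) - f (l i))) < \<epsilon>"
  proof (intro exI[of _ \<delta>] conjI allI impI)
    fix N :: nat and l r
    assume "\<forall>i<N. a \<le> l i \<and> l i \<le> r i \<and> r i \<le> b'"
    then have "\<forall>i<N. a \<le> l i \<and> l i \<le> r i \<and> r i \<le> b" using \<open>b' \<le> b\<close> by fastforce
    then show "(\<Sum>i<N. norm (f (r i) - f (l i))) < \<epsilon>"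
      if "disjoint_family_on (\<lambda>i. {l i<..<r i}) {..<N}" "(\<Sum>i<N. r i - l i) < \<delta>"
      using that by (rule \<delta>)
  qed (fact \<open>\<delta> > 0\<close>)
qed

text \<open>The gauge integral makes this direct.  At a point of differentiability outside the null set \<open>N\<close>
  the gauge is the usual one; at a point of \<open>N\<close> it is an open set \<open>U \<supseteq> N\<close> of measure less than the
  \<open>\<delta>\<close> of absolute continuity.  The cells tagged in \<open>N\<close> are then nonoverlapping and lie in \<open>U\<close>, so
  \<open>f\<close> varies by little over them.  No integrability of \<open>f'\<close> is assumed.\<close>

theorem fundamental_theorem_of_calculus_abs_continuous:
  fixes f :: "real \<Rightarrow> 'a::banach"
  assumes "a \<le> b" and ac: "abs_continuous_on a b f" and N: "negligible N"
    and deriv: "\<And>t. t \<in> {a..b} - N \<Longrightarrow> (f has_vector_derivative f' t) (at t within {a..b})"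
  shows "(f' has_integral (f b - f a)) {a..b}"
proof -
  define g where "g = (\<lambda>t. if t \<in> N then 0 else f' t)"
  have "(g has_integral (f b - f a)) {a..b}"
    unfolding has_integral_real
  proof (intro allI impI)
    fix \<epsilon> :: real assume "0 < \<epsilon>"
    \<comment> \<open>The summand 1 keeps the denominator positive when \<open>a = b\<close>.\<close>
    define e where "e = \<epsilon> / 2 / (b - a + 1)"
    have "0 < e" using \<open>0 < \<epsilon>\<close> \<open>a \<le> b\<close> by (simp add: e_def)
    have eb: "e * (b - a) \<le> \<epsilon> / 2"
      using \<open>0 < \<epsilon>\<close> \<open>a \<le> b\<close> by (simp add: e_def field_simps)
    obtain \<delta> where "\<delta> > 0" and \<delta>: "\<And>(I :: (real \<times> real set) set) l r. \<lbrakk>finite I;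
          \<forall>i\<in>I. a \<le> l i \<and> l i \<le> r i \<and> r i \<le> b;
          disjoint_family_on (\<lambda>i. {l i<..<r i}) I; (\<Sum>i\<in>I. r i - l i) < \<delta>\<rbrakk>
         \<Longrightarrow> (\<Sum>i\<in>I. norm (f (r i) - f (l i))) < \<epsilon> / 2"
      using abs_continuous_on_finite_family[OF ac half_gt_zero[OF \<open>0 < \<epsilon>\<close>]] by blast
    obtain U where U: "open U" "N \<subseteq> U" "U - N \<in> lmeasurable" "emeasure lebesgue (U - N) < ennreal \<delta>"
      using sets_lebesgue_outer_open[OF negligible_imp_sets[OF N] \<open>\<delta> > 0\<close>] .
    have "U = (U - N) \<union> N" using U(2) by blast
    then have U_meas: "U \<in> lmeasurable" "measure lebesgue U < \<delta>"
    proof -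
      show "U \<in> lmeasurable"
        using U(3) negligible_imp_measurable[OF N] \<open>U = (U - N) \<union> N\<close> by (metis fmeasurable.Un)
      have "measure lebesgue U = measure lebesgue (U - N)"
        using N by (metis \<open>U \<in> lmeasurable\<close> fmeasurableD measure_Diff_null_set negligible_iff_null_sets)
      also have "\<dots> < \<delta>"
        using U(3,4) \<open>\<delta> > 0\<close> by (simp add: emeasure_eq_measure2 ennreal_less_iff)
      finally show "measure lebesgue U < \<delta>" .
    qed
    have "\<exists>d>0. \<forall>s\<in>{a..b}. \<bar>s - t\<bar> < d \<longrightarrow> norm (f s - f t - (s - t) *\<^sub>R f' t) \<le> e * \<bar>s - t\<bar>"
      if "t \<in> {a..b} - N" for t
      using deriv[OF that] \<open>0 < e\<close>
      unfolding has_vector_derivative_def has_derivative_within_alt real_norm_def by blast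
    then have "\<forall>t. \<exists>d>0. t \<in> {a..b} - N \<longrightarrow>
        (\<forall>s\<in>{a..b}. \<bar>s - t\<bar> < d \<longrightarrow> norm (f s - f t - (s - t) *\<^sub>R f' t) \<le> e * \<bar>s - t\<bar>)"
      by (metis zero_less_one)
    then obtain d where d: "\<And>t. 0 < d t"
      "\<And>s t. \<lbrakk>t \<in> {a..b} - N; s \<in> {a..b}; \<bar>s - t\<bar> < d t\<rbrakk>
         \<Longrightarrow> norm (f s - f t - (s - t) *\<^sub>R f' t) \<le> e * \<bar>s - t\<bar>"
      by metis
    define \<gamma> where "\<gamma> = (\<lambda>t. if t \<in> N then U else ball t (d t))"
    show "\<exists>\<gamma>. gauge \<gamma> \<and> (\<forall>\<D>. \<D> tagged_division_of {a..b} \<and> \<gamma> fine \<D> \<longrightarrow>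
        norm ((\<Sum>(x, k)\<in>\<D>. measure lborel k *\<^sub>R g x) - (f b - f a)) < \<epsilon>)"
    proof (intro exI[of _ \<gamma>] conjI allI impI)
      show "gauge \<gamma>" using U(1,2) d(1) by (auto simp: gauge_def \<gamma>_def)
      fix \<D> assume "\<D> tagged_division_of {a..b} \<and> \<gamma> fine \<D>"
      then have tag: "\<D> tagged_division_of {a..b}" and fine: "\<gamma> fine \<D>" by auto
      note D = tagged_division_ofD[OF tag]
      have cell: "a \<le> Inf K \<and> Inf K \<le> x \<and> x \<le> Sup K \<and> Sup K \<le> b
          \<and> measure lborel K = Sup K - Inf K \<and> interior K = {Inf K<..<Sup K}
          \<and> Inf K \<in> K \<and> Sup K \<in> K" if xK: "(x, K) \<in> \<D>" for x K
      proof -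
        obtain u v where K: "K = {u..v}" using D(4)[OF xK] by (auto simp: cbox_interval)
        have "u \<le> x" "x \<le> v" using D(2)[OF xK] K by auto
        then have "u \<in> {a..b}" "v \<in> {a..b}" using D(3)[OF xK] K by auto
        with \<open>u \<le> x\<close> \<open>x \<le> v\<close> show ?thesis by (simp add: K)
      qed
      \<comment> \<open>The error of the Riemann sum is split by whether the tag lies in \<open>N\<close>.\<close>
      define \<D>N where "\<D>N = {(x, K) \<in> \<D>. x \<in> N}"
      define \<D>R where "\<D>R = {(x, K) \<in> \<D>. x \<notin> N}"
      have split: "\<D> = \<D>N \<union> \<D>R" "\<D>N \<inter> \<D>R = {}" "finite \<D>N" "finite \<D>R"
        using D(1) by (auto simp: \<D>N_def \<D>R_def intro: rev_finite_subset[OF D(1)])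
      define err where "err = (\<lambda>(x, K). measure lborel K *\<^sub>R g x - (f (Sup K) - f (Inf K)))"
      have "(\<Sum>(x, k)\<in>\<D>. measure lborel k *\<^sub>R g x) - (f b - f a) = sum err \<D>"
        unfolding additive_tagged_division_1[OF \<open>a \<le> b\<close> tag, of f, symmetric]
        by (simp add: err_def sum_subtractf[symmetric] split_def)
      also have "\<dots> = sum err \<D>N + sum err \<D>R"
        unfolding split(1) using split(2-4) by (rule sum.union_disjoint[rotated 2])
      finally have total: "(\<Sum>(x, k)\<in>\<D>. measure lborel k *\<^sub>R g x) - (f b - f a) = sum err \<D>N + sum err \<D>R" .

      have "norm (sum err \<D>R) \<le> (\<Sum>(x, K)\<in>\<D>R. e * measure lborel K)"
      proof (rule sum_norm_le, safe)
        fix x K assume xK: "(x, K) \<in> \<D>R"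
        then have "(x, K) \<in> \<D>" "x \<notin> N" by (auto simp: \<D>R_def)
        note c = cell[OF \<open>(x, K) \<in> \<D>\<close>]
        have "K \<subseteq> ball x (d x)"
          using fineD[OF fine \<open>(x, K) \<in> \<D>\<close>] \<open>x \<notin> N\<close> by (simp add: \<gamma>_def)
        then have near: "\<bar>Inf K - x\<bar> < d x" "\<bar>Sup K - x\<bar> < d x"
          using c by (auto simp: dist_real_def abs_minus_commute subset_iff)
        have "x \<in> {a..b} - N" "Inf K \<in> {a..b}" "Sup K \<in> {a..b}"
          using c \<open>x \<notin> N\<close> by auto
        note bd = d(2)[OF this(1,2) near(1)] d(2)[OF this(1,3) near(2)]
        have "err (x, K) = (f (Inf K) - f x - (Inf K - x) *\<^sub>R f' x)
            - (f (Sup K) - f x - (Sup K - x) *\<^sub>R f' x)"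
          using c \<open>x \<notin> N\<close> by (simp add: err_def g_def scaleR_diff_left)
        also have "norm \<dots> \<le> e * \<bar>Inf K - x\<bar> + e * \<bar>Sup K - x\<bar>"
          by (rule order.trans[OF norm_triangle_ineq4 add_mono[OF bd]])
        also have "\<dots> = e * (Sup K - Inf K)" using c by (simp add: algebra_simps)
        also have "\<dots> = e * measure lborel K" using c by presburger
        finally show "norm (err (x, K)) \<le> e * measure lborel K" .
      qed
      also have "\<dots> \<le> (\<Sum>(x, K)\<in>\<D>. e * measure lborel K)"
        using D(1) \<open>0 < e\<close> by (intro sum_mono2) (auto simp: \<D>R_def)
      also have "\<dots> = e * (b - a)"
        using additive_content_tagged_division[of \<D> a b] tag \<open>a \<le> b\<close>
        by (simp add: sum_distrib_left[symmetric] split_def)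
      finally have R: "norm (sum err \<D>R) \<le> \<epsilon> / 2" using eb by linarith

      have part: "\<D>N tagged_partial_division_of {a..b}"
        by (rule tagged_partial_division_subset[of \<D>])
          (use tag in \<open>auto simp: \<D>N_def tagged_division_of_def\<close>)
      have "(\<Sum>(x, K)\<in>\<D>N. norm (f (Sup K) - f (Inf K)))
          = (\<Sum>i\<in>\<D>N. norm (f (Sup (snd i)) - f (Inf (snd i))))"
        by (simp add: split_def)
      also have "\<dots> < \<epsilon> / 2"
      proof (rule \<delta>[where l = "\<lambda>i. Inf (snd i)" and r = "\<lambda>i. Sup (snd i)"])
        show "finite \<D>N" by (fact split(3))
        show "\<forall>i\<in>\<D>N. a \<le> Inf (snd i) \<and> Inf (snd i) \<le> Sup (snd i) \<and> Sup (snd i) \<le> b"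
        proof
          fix i assume "i \<in> \<D>N"
          then have "(fst i, snd i) \<in> \<D>" by (auto simp: \<D>N_def)
          from cell[OF this] show "a \<le> Inf (snd i) \<and> Inf (snd i) \<le> Sup (snd i) \<and> Sup (snd i) \<le> b"
            by linarith
        qed
        show "disjoint_family_on (\<lambda>i. {Inf (snd i)<..<Sup (snd i)}) \<D>N"
          unfolding disjoint_family_on_def
        proof (intro ballI impI)
          fix i j assume ij: "i \<in> \<D>N" "j \<in> \<D>N" "i \<noteq> j"
          then have "(fst i, snd i) \<in> \<D>" "(fst j, snd j) \<in> \<D>" by (auto simp: \<D>N_def)
          then have "interior (snd i) = {Inf (snd i)<..<Sup (snd i)}"
            and "interior (snd j) = {Inf (snd j)<..<Sup (snd j)}"
            using cell by blast+
          then show "{Inf (snd i)<..<Sup (snd i)} \<inter> {Inf (snd j)<..<Sup (snd j)} = {}"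
            using tagged_partial_division_ofD(5)[OF part, of "fst i" "snd i" "fst j" "snd j"] ij
            by simp
        qed
        have "(\<Sum>i\<in>\<D>N. Sup (snd i) - Inf (snd i)) = (\<Sum>(x, K)\<in>\<D>N. measure lborel K)"
          by (rule sum.cong) (use cell in \<open>auto simp: \<D>N_def\<close>)
        also have "\<dots> = sum (measure lborel) (snd ` \<D>N)"
          by (rule sum.over_tagged_division_lemma[OF tagged_partial_division_of_Union_self[OF part]])
            (simp add: content_eq_0_interior)
        also have "\<dots> = measure lebesgue (\<Union>(snd ` \<D>N))"
        proof -
          have "measure lborel K = measure lebesgue K" if "K \<in> snd ` \<D>N" for K
            using division_ofD(4)[OF partial_division_of_tagged_division[OF part] that]
            by (auto simp: measure_completion)
          then show ?thesis
            using content_division[OF partial_division_of_tagged_division[OF part]] by simp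
        qed
        also have "\<dots> \<le> measure lebesgue U"
        proof (rule measure_mono_fmeasurable)
          show "\<Union>(snd ` \<D>N) \<subseteq> U"
          proof clarify
            fix t x K assume "(x, K) \<in> \<D>N" "t \<in> snd (x, K)"
            then show "t \<in> U"
              using fineD[OF fine, of x K] by (auto simp: \<D>N_def \<gamma>_def)
          qed
          show "\<Union>(snd ` \<D>N) \<in> sets lebesgue"
            using lmeasurable_division[OF partial_division_of_tagged_division[OF part]] by blast
        qed (fact U_meas(1))
        also have "\<dots> < \<delta>" by (fact U_meas(2))
        finally show "(\<Sum>i\<in>\<D>N. Sup (snd i) - Inf (snd i)) < \<delta>" .
      qed
      finally have "(\<Sum>(x, K)\<in>\<D>N. norm (f (Sup K) - f (Inf K))) < \<epsilon> / 2" .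
      moreover have "norm (sum err \<D>N) \<le> (\<Sum>(x, K)\<in>\<D>N. norm (f (Sup K) - f (Inf K)))"
        by (rule sum_norm_le) (auto simp: err_def g_def \<D>N_def norm_minus_commute)
      ultimately show "norm ((\<Sum>(x, k)\<in>\<D>. measure lborel k *\<^sub>R g x) - (f b - f a)) < \<epsilon>"
        unfolding total using R norm_triangle_ineq[of "sum err \<D>N" "sum err \<D>R"] by linarith
    qed
  qed
  then show ?thesis
    by (rule has_integral_spike[OF N, rotated]) (simp add: g_def)
qed

section \<open>A Gronwall-type inequality\<close>

lemma AE_lebesgue_onE:
  assumes "AE t in lebesgue_on S. P t" and "S \<in> sets lebesgue"
  obtains N where "negligible N" and "\<And>t. t \<in> S - N \<Longrightarrow> P t"
proof -
  have "AE t in lebesgue. t \<in> S \<longrightarrow> P t"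
    using assms by (simp add: AE_restrict_space_iff)
  then obtain N where "N \<in> null_sets lebesgue" "{t \<in> space lebesgue. \<not> (t \<in> S \<longrightarrow> P t)} \<subseteq> N"
    by (auto simp only: eventually_ae_filter)
  then show thesis
    by (intro that[of N]) (auto simp: negligible_iff_null_sets)
qed

text \<open>A sharp form of the Gronwall inequality for \<open>1/2 (d/dt) \<parallel>\<zeta>\<parallel>\<^sup>2 \<le> \<parallel>\<zeta>\<parallel> g + \<beta>\<close>: the quantity
  \<open>G(t) = (\<parallel>\<zeta>(t)\<parallel>\<^sup>2 + \<epsilon>\<^sup>2 + 2 \<integral>\<^sub>t\<^sup>T \<beta>)\<^sup>1\<^sup>/\<^sup>2\<close> is absolutely continuous and satisfies \<open>G' \<le> g\<close>
  almost everywhere, because the term \<open>\<beta>\<close> is cancelled by the derivative of the integral.\<close>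

lemma norm_le_of_energy_inequality:
  fixes \<zeta> :: "real \<Rightarrow> 'a::euclidean_space" and g \<beta> :: "real \<Rightarrow> real"
  assumes ac: "abs_continuous_on 0 T \<zeta>"
    and g: "integrable (lebesgue_on {0..T}) g" "\<And>t. 0 \<le> g t"
    and \<beta>: "continuous_on {0..T} \<beta>" "\<And>t. 0 \<le> \<beta> t"
    and energy_ineq: "AE t in lebesgue_on {0..T}. \<exists>\<zeta>'. (\<zeta> has_vector_derivative \<zeta>') (at t) \<and>
      \<zeta> t \<bullet> \<zeta>' \<le> norm (\<zeta> t) * g t + \<beta> t"
    and t: "t \<in> {0..T}"
  shows "norm (\<zeta> t) \<le> norm (\<zeta> 0) + (LINT t|lebesgue_on {0..T}. g t)
    + sqrt (2 * (LINT t|lebesgue_on {0..T}. \<beta> t))"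
proof (rule field_le_epsilon)
  fix \<epsilon> :: real assume "0 < \<epsilon>"
  define S where "S = (\<lambda>u. \<epsilon>\<^sup>2 + 2 * integral {u..T} \<beta>)"
  define r where "r = (\<lambda>u. sqrt (S u))"
  define G where "G = (\<lambda>u. sqrt (\<zeta> u \<bullet> \<zeta> u + S u))"
  have S_ge: "\<epsilon>\<^sup>2 \<le> S u" for u
    using integral_nonneg[of \<beta> "{u..T}"] \<beta>(2)
    by (cases "\<beta> integrable_on {u..T}") (auto simp: S_def not_integrable_integral)
  have S_pos: "0 < S u" for u
    using S_ge[of u] \<open>0 < \<epsilon>\<close> by (metis less_le_trans zero_less_power)
  have r_ge: "\<epsilon> \<le> r u" for u
    using real_le_rsqrt[OF S_ge[of u]] by (simp add: r_def)
  have G_pair: "G u = norm (\<zeta> u, r u)" for u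
    using S_pos[of u] by (simp add: G_def r_def norm_prod_def dot_square_norm)
  have G_pos: "0 < G u" for u
    using S_pos[of u] by (simp add: G_def add_nonneg_pos)
  have norm_le_G: "norm (\<zeta> u) \<le> G u" for u
    unfolding G_pair by (metis fst_conv norm_fst_le)
  have S_deriv: "(S has_real_derivative - 2 * \<beta> u) (at u within {0..T})" if "u \<in> {0..T}" for u
    using integral_has_vector_derivative'[OF \<beta>(1) that] unfolding S_def
    by (auto intro!: derivative_eq_intros simp: has_real_derivative_iff_has_vector_derivative[symmetric])

  \<comment> \<open>Staying above \<open>\<epsilon>\<close> keeps \<open>r\<close> away from the singularity of the square root.\<close>
  have "\<exists>L. L-lipschitz_on {0..T} r"
  proof -
    have "compact (\<beta> ` {0..T})" by (rule compact_continuous_image[OF \<beta>(1) compact_Icc])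
    then obtain B where "0 < B" and B: "\<And>u. u \<in> {0..T} \<Longrightarrow> norm (\<beta> u) \<le> B"
      using compact_imp_bounded[of "\<beta> ` {0..T}"] by (auto simp: bounded_pos)
    have "(B / \<epsilon>)-lipschitz_on {0..T} r"
    proof (rule bounded_derivative_imp_lipschitz)
      show "(r has_derivative (*) (- \<beta> u / r u)) (at u within {0..T})" if "u \<in> {0..T}" for u
        unfolding has_field_derivative_def[symmetric] r_def
        using S_deriv[OF that] S_pos[of u]
        by (auto intro!: derivative_eq_intros simp: field_simps)
      show "onorm ((*) (- \<beta> u / r u)) \<le> B / \<epsilon>" if "u \<in> {0..T}" for u
      proof (rule onorm_le)
        fix v
        have "\<bar>\<beta> u / r u\<bar> \<le> B / \<epsilon>"
          using B[OF that] r_ge[of u] \<open>0 < \<epsilon>\<close> \<open>0 < B\<close> by (simp add: frac_le)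
        then show "norm (- \<beta> u / r u * v) \<le> B / \<epsilon> * norm v"
          using mult_right_mono[of "\<bar>\<beta> u / r u\<bar>" "B / \<epsilon>" "\<bar>v\<bar>"] by (simp add: abs_mult)
      qed
    qed (use \<open>0 < B\<close> \<open>0 < \<epsilon>\<close> in auto)
    then show ?thesis by blast
  qed
  then have "abs_continuous_on 0 T r" using lipschitz_imp_abs_continuous_on by blast
  then have "abs_continuous_on 0 T G"
  proof (rule abs_continuous_on_dominated[OF ac])
    fix u v
    have "norm (G v - G u) \<le> norm ((\<zeta> v, r v) - (\<zeta> u, r u))"
      unfolding G_pair real_norm_def by (rule norm_triangle_ineq3)
    also have "\<dots> \<le> norm (\<zeta> v - \<zeta> u) + norm (r v - r u)"
      by (simp only: diff_Pair norm_Pair_le)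
    finally show "norm (G v - G u) \<le> norm (\<zeta> v - \<zeta> u) + norm (r v - r u)" .
  qed
  then have G_ac: "abs_continuous_on 0 t G"
    by (rule abs_continuous_on_subinterval) (use t in simp)

  obtain N0 where N0: "negligible N0" and "\<And>u. u \<in> {0..T} - N0 \<Longrightarrow>
      \<exists>\<zeta>'. (\<zeta> has_vector_derivative \<zeta>') (at u) \<and> \<zeta> u \<bullet> \<zeta>' \<le> norm (\<zeta> u) * g u + \<beta> u"
    using AE_lebesgue_onE[OF energy_ineq] by auto
  then obtain \<zeta>' where \<zeta>': "\<And>u. u \<in> {0..T} - N0 \<Longrightarrow> (\<zeta> has_vector_derivative \<zeta>' u) (at u)"
      "\<And>u. u \<in> {0..T} - N0 \<Longrightarrow> \<zeta> u \<bullet> \<zeta>' u \<le> norm (\<zeta> u) * g u + \<beta> u"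
    by metis
  \<comment> \<open>The endpoints are discarded because \<open>S\<close> is only known to be differentiable from inside the interval.\<close>
  define N where "N = N0 \<union> {0, T}"
  \<comment> \<open>The value 0 on \<open>N\<close> is still at most \<open>g\<close>.\<close>
  define G' where "G' = (\<lambda>u. if u \<in> N then 0 else (\<zeta> u \<bullet> \<zeta>' u - \<beta> u) / G u)"
  have "(G' has_integral (G t - G 0)) {0..t}"
  proof (rule fundamental_theorem_of_calculus_abs_continuous[OF _ G_ac])
    show "0 \<le> t" using t by simp
    show "negligible N" using N0 by (simp add: N_def)
    fix u assume "u \<in> {0..t} - N"
    then have u: "u \<in> {0..T} - N0" "0 < u" "u < T" "u \<notin> N" using t by (auto simp: N_def)
    have S': "(S has_real_derivative - 2 * \<beta> u) (at u)"
      using S_deriv[of u] u by (simp add: at_within_Icc_at)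
    have pos: "0 < \<zeta> u \<bullet> \<zeta> u + S u" using S_pos[of u] by (simp add: add_nonneg_pos)
    have \<zeta>\<zeta>': "((\<lambda>u. \<zeta> u \<bullet> \<zeta> u) has_real_derivative 2 * (\<zeta> u \<bullet> \<zeta>' u)) (at u)"
      using bounded_bilinear.has_vector_derivative[OF bounded_bilinear_inner \<zeta>'(1)[OF u(1)] \<zeta>'(1)[OF u(1)]]
      by (simp add: has_real_derivative_iff_has_vector_derivative inner_commute)
    have "(G has_real_derivative inverse (G u) / 2 * (2 * (\<zeta> u \<bullet> \<zeta>' u) + - 2 * \<beta> u)) (at u)"
      unfolding G_def by (rule DERIV_chain2[OF DERIV_real_sqrt[OF pos] DERIV_add[OF \<zeta>\<zeta>' S']])
    moreover have "inverse (G u) / 2 * (2 * (\<zeta> u \<bullet> \<zeta>' u) + - 2 * \<beta> u) = (\<zeta> u \<bullet> \<zeta>' u - \<beta> u) / G u"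
      using G_pos[of u] by (simp add: field_simps)
    ultimately have "(G has_real_derivative (\<zeta> u \<bullet> \<zeta>' u - \<beta> u) / G u) (at u)"
      by (simp only:)
    then show "(G has_vector_derivative G' u) (at u within {0..t})"
      using u(4) by (simp add: G'_def has_real_derivative_iff_has_vector_derivative
          has_vector_derivative_at_within)
  qed
  moreover have g_int: "g integrable_on {0..T}"
    using has_integral_integral_lebesgue_on[OF g(1)] by auto
  then have g_sub: "g integrable_on {0..t}"
    using t by (auto intro: integrable_subinterval_real)
  moreover have "G' u \<le> g u" if "u \<in> {0..t}" for u
  proof (cases "u \<in> N")
    case False
    then have "\<zeta> u \<bullet> \<zeta>' u - \<beta> u \<le> norm (\<zeta> u) * g u"
      using \<zeta>'(2)[of u] that t by (auto simp: N_def)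
    also have "\<dots> \<le> G u * g u"
      using norm_le_G g(2) by (intro mult_right_mono)
    finally show ?thesis
      using False G_pos[of u] by (simp add: G'_def field_simps)
  qed (simp add: G'_def g(2))
  ultimately have "G t - G 0 \<le> integral {0..t} g"
    by (intro has_integral_le[OF _ integrable_integral])
  also have "\<dots> \<le> integral {0..T} g"
    using t g(2) by (intro integral_subset_le g_sub g_int) auto
  also have "\<dots> = (LINT t|lebesgue_on {0..T}. g t)"
    using g(1) by (simp add: lebesgue_integral_eq_integral)
  finally have "G t \<le> G 0 + (LINT t|lebesgue_on {0..T}. g t)" by simp
  moreover have "G 0 \<le> norm (\<zeta> 0) + \<epsilon> + sqrt (2 * (LINT t|lebesgue_on {0..T}. \<beta> t))"
  proof -
    have "integrable (lebesgue_on {0..T}) \<beta>" by (rule continuous_imp_integrable_real[OF \<beta>(1)])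
    then have S0: "S 0 = \<epsilon>\<^sup>2 + 2 * (LINT t|lebesgue_on {0..T}. \<beta> t)"
      by (simp add: S_def lebesgue_integral_eq_integral)
    have nn: "0 \<le> (LINT t|lebesgue_on {0..T}. \<beta> t)" using \<beta>(2) by simp
    have "G 0 \<le> norm (\<zeta> 0) + r 0"
      unfolding G_pair using norm_Pair_le[of "\<zeta> 0" "r 0"] r_ge[of 0] \<open>0 < \<epsilon>\<close> by simp
    also have "r 0 \<le> sqrt (\<epsilon>\<^sup>2) + sqrt (2 * (LINT t|lebesgue_on {0..T}. \<beta> t))"
      unfolding r_def S0 using nn by (intro sqrt_add_le_add_sqrt) auto
    finally show ?thesis using \<open>0 < \<epsilon>\<close> by simp
  qed
  ultimately show "norm (\<zeta> t) \<le> norm (\<zeta> 0) + (LINT t|lebesgue_on {0..T}. g t)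
    + sqrt (2 * (LINT t|lebesgue_on {0..T}. \<beta> t)) + \<epsilon>"
    using norm_le_G[of t] by linarith
qed

section \<open>Growth of the subgradients of the energy\<close>

lemma edge_osc_ge:
  assumes "u \<in> e" and "v \<in> e"
  shows "x $ u - x $ v \<le> edge_osc e x"
  unfolding edge_osc_def using assms by (intro Max_ge) auto

lemma edge_osc_le:
  assumes "e \<noteq> {}" and "\<And>u v. \<lbrakk>u \<in> e; v \<in> e\<rbrakk> \<Longrightarrow> x $ u - x $ v \<le> c"
  shows "edge_osc e x \<le> c"
  unfolding edge_osc_def using assms by (subst Max_le_iff) auto

lemma edge_osc_nonneg:
  assumes "e \<noteq> {}"
  shows "0 \<le> edge_osc e x"
  using assms edge_osc_ge[of _ e _ x] by force

lemma edge_osc_le_norm: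
  assumes "e \<noteq> {}"
  shows "edge_osc e x \<le> 2 * norm x"
proof (rule edge_osc_le[OF assms])
  fix u v
  show "x $ u - x $ v \<le> 2 * norm x"
    using component_le_norm_cart[of x u] component_le_norm_cart[of x v] by linarith
qed

lemma edge_osc_triangle:
  assumes "e \<noteq> {}"
  shows "edge_osc e (x + y) \<le> edge_osc e x + edge_osc e y"
proof (rule edge_osc_le[OF assms])
  fix u v assume "u \<in> e" "v \<in> e"
  then show "(x + y) $ u - (x + y) $ v \<le> edge_osc e x + edge_osc e y"
    using edge_osc_ge[of u e v x] edge_osc_ge[of u e v y] by simp
qed

text \<open>A one-sided Lipschitz bound for the power function, with a Lipschitz constant that can be read off
  from an upper bound \<open>r\<close> of the larger argument.  The mean value theorem needs a positive left endpoint,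
  so \<open>b = 0\<close> is treated separately.\<close>

lemma powr_diff_le:
  fixes a b c p :: real
  assumes "1 \<le> p" and "0 \<le> b" and "0 \<le> a" and "a \<le> r" and "a - b \<le> c" and "0 \<le> c"
  shows "a powr p - b powr p \<le> p * r powr (p - 1) * c"
proof (cases "a \<le> b")
  case True
  then have "a powr p \<le> b powr p" using assms by (intro powr_mono2) auto
  then show ?thesis using assms by (smt (verit) mult_nonneg_nonneg powr_ge_zero)
next
  case False
  then have "b < a" by simp
  have r: "a powr (p - 1) \<le> r powr (p - 1)" using assms by (intro powr_mono2) auto
  have "a powr p - b powr p \<le> p * a powr (p - 1) * (a - b)"
  proof (cases "b = 0")
    case True
    have "a powr p = a powr (p - 1) * a"
      using \<open>b < a\<close> \<open>0 \<le> b\<close> by (simp add: powr_diff)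
    also have "\<dots> \<le> p * (a powr (p - 1) * a)"
      using \<open>1 \<le> p\<close> \<open>0 \<le> a\<close> mult_right_mono[of 1 p "a powr (p - 1) * a"] by simp
    finally show ?thesis using True by simp
  next
    case False
    then have "0 < b" using assms by simp
    have "\<exists>z. b < z \<and> z < a \<and> a powr p - b powr p = (a - b) * (p * z powr (p - 1))"
      using \<open>b < a\<close> \<open>0 < b\<close>
      by (intro MVT2[of b a "\<lambda>z. z powr p" "\<lambda>z. p * z powr (p - 1)"])
        (auto intro!: derivative_eq_intros simp: powr_diff)
    then obtain z where z: "b < z" "z < a" "a powr p - b powr p = (a - b) * (p * z powr (p - 1))"
      by blast
    have "z powr (p - 1) \<le> a powr (p - 1)"
      using z \<open>0 < b\<close> \<open>1 \<le> p\<close> by (intro powr_mono2) auto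
    then show ?thesis
      unfolding z(3) using \<open>b < a\<close> \<open>1 \<le> p\<close>
      by (simp add: mult.commute[of "a - b"] mult_left_mono mult_right_mono)
  qed
  also have "\<dots> \<le> p * r powr (p - 1) * c"
    using r assms \<open>b < a\<close> by (intro mult_mono) auto
  finally show ?thesis .
qed

lemma energy_diff_le:
  assumes "hypergraph E w" and "1 \<le> p"
  shows "energy p E w (x + y) - energy p E w x
    \<le> 2 * (\<Sum>e\<in>E. w e) * (2 * (norm x + norm y)) powr (p - 1) * norm y"
proof -
  let ?r = "2 * (norm x + norm y)"
  have "energy p E w (x + y) - energy p E w x
      = (\<Sum>e\<in>E. w e * (1 / p * (edge_osc e (x + y) powr p - edge_osc e x powr p)))"
    by (simp add: energy_def sum_subtractf[symmetric] sum_distrib_left sum_divide_distrib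
        algebra_simps diff_divide_distrib)
  also have "\<dots> \<le> (\<Sum>e\<in>E. w e * (?r powr (p - 1) * (2 * norm y)))"
  proof (rule sum_mono)
    fix e assume "e \<in> E"
    then have "0 < w e" and "e \<noteq> {}"
      using assms(1) by (auto simp: hypergraph_def)
    have "edge_osc e (x + y) powr p - edge_osc e x powr p \<le> p * ?r powr (p - 1) * (2 * norm y)"
    proof (rule powr_diff_le)
      show "edge_osc e (x + y) \<le> ?r"
        using edge_osc_le_norm[OF \<open>e \<noteq> {}\<close>, of "x + y"] norm_triangle_ineq[of x y]
        by (auto intro: order.trans)
      show "edge_osc e (x + y) - edge_osc e x \<le> 2 * norm y"
        using edge_osc_triangle[OF \<open>e \<noteq> {}\<close>, of x y] edge_osc_le_norm[OF \<open>e \<noteq> {}\<close>, of y] by linarith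
    qed (use assms(2) edge_osc_nonneg[OF \<open>e \<noteq> {}\<close>] in auto)
    then have "1 / p * (edge_osc e (x + y) powr p - edge_osc e x powr p)
        \<le> ?r powr (p - 1) * (2 * norm y)"
      using assms(2) by (simp add: field_simps)
    then show "w e * (1 / p * (edge_osc e (x + y) powr p - edge_osc e x powr p))
        \<le> w e * (?r powr (p - 1) * (2 * norm y))"
      using \<open>0 < w e\<close> by (intro mult_left_mono) auto
  qed
  also have "\<dots> = 2 * (\<Sum>e\<in>E. w e) * ?r powr (p - 1) * norm y"
    by (simp add: sum_distrib_right[symmetric])
  finally show ?thesis .
qed

lemma norm_pow_nonneg: "0 \<le> norm_pow p x"
  by (simp add: norm_pow_def)

lemma norm_pow_square: "(norm_pow p x)\<^sup>2 = (if p = 1 then 1 else norm x powr (p - 1))"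
  by (simp add: norm_pow_def power2_eq_square powr_add[symmetric])

text \<open>The growth of the subgradients.  Testing the subgradient inequality with a step of length \<open>s\<close> in the
  direction of \<open>\<eta>\<close> bounds \<open>\<parallel>\<eta>\<parallel>\<close> by a multiple of \<open>(\<parallel>x\<parallel> + s)\<^sup>p\<^sup>-\<^sup>1\<close>; the claim follows as \<open>s\<close> tends
  to 0.  At \<open>p = 1\<close> the limit is 1 even when \<open>x = 0\<close>, in agreement with \<open>norm_pow\<close>.\<close>

lemma energy_subgradient_le:
  assumes "hypergraph E w" and "1 \<le> p"
    and \<eta>: "\<eta> \<in> subdifferential (\<lambda>y. ereal (energy p E w y)) x"
  shows "norm \<eta> \<le> 2 powr p * (\<Sum>e\<in>E. w e) * (norm_pow p x)\<^sup>2"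
proof -
  let ?C = "2 powr p * (\<Sum>e\<in>E. w e)"
  have "0 \<le> (\<Sum>e\<in>E. w e)"
    using assms(1) by (auto simp: hypergraph_def intro!: sum_nonneg intro: less_imp_le)
  have step: "norm \<eta> \<le> ?C * (norm x + s) powr (p - 1)" if "0 < s" for s
  proof (cases "\<eta> = 0")
    case True
    then show ?thesis using \<open>0 \<le> (\<Sum>e\<in>E. w e)\<close> by simp
  next
    case False
    define y where "y = (s / norm \<eta>) *\<^sub>R \<eta>"
    have "norm y = s" using False \<open>0 < s\<close> by (simp add: y_def)
    have "s * norm \<eta> = \<eta> \<bullet> ((x + y) - x)"
      using False by (simp add: y_def dot_square_norm power2_eq_square)
    also have "\<dots> \<le> energy p E w (x + y) - energy p E w x"
    proof -
      have "\<forall>z. \<eta> \<bullet> (z - x) \<le> energy p E w z - energy p E w x"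
        using \<eta> by (simp add: subdifferential_def)
      then show ?thesis by blast
    qed
    also have "\<dots> \<le> 2 * (\<Sum>e\<in>E. w e) * (2 * (norm x + s)) powr (p - 1) * s"
      using energy_diff_le[OF assms(1,2), of x y] \<open>norm y = s\<close> by simp
    also have "\<dots> = s * (?C * (norm x + s) powr (p - 1))"
    proof -
      have "(2 * (norm x + s)) powr (p - 1) = 2 powr (p - 1) * (norm x + s) powr (p - 1)"
        using \<open>0 < s\<close> by (simp add: powr_mult del: distrib_left_numeral)
      then show ?thesis using powr_add[of 2 1 "p - 1"] by simp
    qed
    finally show ?thesis using \<open>0 < s\<close> by simp
  qed
  have "((\<lambda>s. ?C * (norm x + s) powr (p - 1)) \<longlongrightarrow> ?C * (norm_pow p x)\<^sup>2) (at_right 0)"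
  proof (cases "p = 1")
    case True
    have "\<forall>\<^sub>F s in at_right (0::real). ?C * (norm x + s) powr (p - 1) = ?C * (norm_pow p x)\<^sup>2"
      using eventually_at_right_less[of 0]
    proof eventually_elim
      case (elim s)
      then have "norm x + s > 0" by (simp add: add_nonneg_pos)
      then show ?case using True by (simp add: norm_pow_square)
    qed
    then show ?thesis by (rule tendsto_eventually)
  next
    case False
    have "((\<lambda>s. (norm x + s) powr (p - 1)) \<longlongrightarrow> (norm x + 0) powr (p - 1)) (at_right 0)"
    proof (rule tendsto_powr')
      show "((\<lambda>s. norm x + s) \<longlongrightarrow> norm x + 0) (at_right 0)"
        by (intro tendsto_intros)
      show "norm x + 0 \<noteq> 0 \<or> 0 < p - 1 \<and> (\<forall>\<^sub>F s in at_right 0. 0 \<le> norm x + s)"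
        using False assms(2) eventually_at_right_less[of 0]
        by (auto elim!: eventually_mono intro: add_nonneg_nonneg)
    qed simp
    then show ?thesis
      using False by (simp add: norm_pow_square tendsto_mult_left)
  qed
  then show ?thesis
  proof (rule tendsto_lowerbound)
    show "\<forall>\<^sub>F s in at_right 0. norm \<eta> \<le> ?C * (norm x + s) powr (p - 1)"
      using eventually_at_right_less[of 0] by eventually_elim (rule step)
  qed simp
qed

section \<open>The energy estimate for the free coordinates\<close>

text \<open>The projection of the state space onto the free coordinates.  It is kept as a map of the state
  space into itself, with zero prescribed coordinates, so that inner products with subgradients make
  sense.\<close>

definition free_part :: "real ^ ('n::finite + 'm::finite) \<Rightarrow> real ^ ('n + 'm)" where
  "free_part x = (\<chi> k. case k of Inl i \<Rightarrow> x $ Inl i | Inr j \<Rightarrow> 0)"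

lemma free_part_nth [simp]:
  "free_part x $ Inl i = x $ Inl i"
  "free_part x $ Inr j = 0"
  by (simp_all add: free_part_def)

lemma vec_sum_eq_iff:
  fixes x y :: "real ^ ('n::finite + 'm::finite)"
  shows "x = y \<longleftrightarrow> (\<forall>i. x $ Inl i = y $ Inl i) \<and> (\<forall>j. x $ Inr j = y $ Inr j)"
  unfolding vec_eq_iff by (metis sum.exhaust)

lemma sum_UNIV_Plus:
  fixes f :: "'n::finite + 'm::finite \<Rightarrow> 'a::comm_monoid_add"
  shows "(\<Sum>k\<in>UNIV. f k) = (\<Sum>i\<in>UNIV. f (Inl i)) + (\<Sum>j\<in>UNIV. f (Inr j))"
  by (simp add: sum.Plus flip: UNIV_Plus_UNIV)

lemma bounded_linear_free_part: "bounded_linear free_part"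
  unfolding linear_conv_bounded_linear[symmetric]
  by (rule linearI) (simp_all add: vec_sum_eq_iff)

lemmas free_part_simps =
  linear_add[OF bounded_linear.linear[OF bounded_linear_free_part]]
  linear_diff[OF bounded_linear.linear[OF bounded_linear_free_part]]

lemma inner_free_part: "free_part x \<bullet> free_part y = free_part x \<bullet> y"
  by (simp add: inner_vec_def sum_UNIV_Plus)

lemma norm_free_part: "norm (free_part x) = sqrt (\<Sum>i\<in>UNIV. \<bar>x $ Inl i\<bar>\<^sup>2)"
  by (simp add: norm_vec_def L2_set_def sum_UNIV_Plus)

lemma norm_free_part_le: "norm (free_part x) \<le> norm x"
  unfolding norm_free_part norm_vec_def L2_set_def
  by (rule real_sqrt_le_mono) (simp add: sum_UNIV_Plus sum_nonneg)

lemma subdifferential_indicator_imp_mem: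
  "\<xi> \<in> subdifferential (convex_indicator K) x \<Longrightarrow> x \<in> K"
  by (auto simp: subdifferential_def convex_indicator_def split: if_splits)

text \<open>The constraint force acts on the prescribed coordinates only, since \<open>x\<close> may be moved freely within
  the affine subspace along the free coordinates.\<close>

lemma free_part_subdifferential_constraint:
  assumes \<xi>: "\<xi> \<in> subdifferential (convex_indicator (constraint_set b)) x"
  shows "free_part \<xi> = 0"
proof -
  have x: "x \<in> constraint_set b" using subdifferential_indicator_imp_mem[OF \<xi>] .
  then have "x + free_part \<xi> \<in> constraint_set b" by (simp add: constraint_set_def)
  moreover have "ereal (\<xi> \<bullet> (z - x))
      \<le> convex_indicator (constraint_set b) z - convex_indicator (constraint_set b) x" for z
    using \<xi> by (auto simp: subdifferential_def split: if_splits)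
  from this[of "x + free_part \<xi>"]
  have "ereal (\<xi> \<bullet> free_part \<xi>) \<le> convex_indicator (constraint_set b) (x + free_part \<xi>)
      - convex_indicator (constraint_set b) x" by simp
  ultimately have "\<xi> \<bullet> free_part \<xi> \<le> 0" using x by (simp add: convex_indicator_def)
  then have "free_part \<xi> \<bullet> free_part \<xi> \<le> 0" by (simp add: inner_free_part inner_commute)
  then show ?thesis by (metis inner_eq_zero_iff inner_ge_zero order_antisym)
qed

lemma subdifferential_monotone:
  fixes \<phi> :: "'a::real_inner \<Rightarrow> real"
  assumes "\<eta>1 \<in> subdifferential (\<lambda>y. ereal (\<phi> y)) x1" and "\<eta>2 \<in> subdifferential (\<lambda>y. ereal (\<phi> y)) x2"
  shows "0 \<le> (\<eta>1 - \<eta>2) \<bullet> (x1 - x2)"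
proof -
  have "\<eta>1 \<bullet> (x2 - x1) \<le> \<phi> x2 - \<phi> x1" and "\<eta>2 \<bullet> (x1 - x2) \<le> \<phi> x1 - \<phi> x2"
    using assms by (simp_all add: subdifferential_def)
  then show ?thesis by (simp add: inner_diff_left inner_diff_right)
qed

text \<open>The energy estimate at one instant.  Monotonicity of the subdifferential applies to \<open>x1 - x2\<close>, not
  to its free part; the two differ by \<open>b1 - b2\<close>, and this difference costs the subgradient bound.\<close>

lemma free_part_dissipation:
  fixes x1 x2 b1 b2 h1 h2 x1' x2' :: "real ^ ('n::finite + 'm::finite)"
  assumes \<eta>: "\<eta>1 \<in> subdifferential (\<lambda>y. ereal (\<phi> y)) x1" "\<eta>2 \<in> subdifferential (\<lambda>y. ereal (\<phi> y)) x2"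
    and \<xi>: "\<xi>1 \<in> subdifferential (convex_indicator (constraint_set b1)) x1"
      "\<xi>2 \<in> subdifferential (convex_indicator (constraint_set b2)) x2"
    and eqs: "x1' + \<eta>1 + \<xi>1 = h1" "x2' + \<eta>2 + \<xi>2 = h2"
    and b: "\<And>i. b1 $ Inl i = 0" "\<And>i. b2 $ Inl i = 0"
  shows "free_part (x1 - x2) \<bullet> free_part (x1' - x2')
    \<le> norm (free_part (x1 - x2)) * norm (h1 - h2) + norm (b1 - b2) * (norm \<eta>1 + norm \<eta>2)"
proof -
  let ?z = "free_part (x1 - x2)"
  have "x1 \<in> constraint_set b1" "x2 \<in> constraint_set b2"
    using \<xi> by (auto dest: subdifferential_indicator_imp_mem)
  then have z: "?z = (x1 - x2) - (b1 - b2)"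
    using b by (simp add: vec_sum_eq_iff constraint_set_def)
  have "?z \<bullet> (\<xi>1 - \<xi>2) = 0"
    using \<xi>[THEN free_part_subdifferential_constraint]
    by (metis inner_free_part free_part_simps(2) diff_self inner_zero_right)
  moreover have "x1' - x2' = (h1 - h2) - (\<eta>1 - \<eta>2) - (\<xi>1 - \<xi>2)"
    unfolding eqs[symmetric] by simp
  ultimately have "?z \<bullet> free_part (x1' - x2') = ?z \<bullet> (h1 - h2) - ?z \<bullet> (\<eta>1 - \<eta>2)"
    by (simp add: inner_free_part inner_diff_right)
  also have "\<dots> = ?z \<bullet> (h1 - h2) + (b1 - b2) \<bullet> (\<eta>1 - \<eta>2) - (\<eta>1 - \<eta>2) \<bullet> (x1 - x2)"
    unfolding z by (simp add: inner_diff_left inner_diff_right inner_commute)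
  also have "\<dots> \<le> norm ?z * norm (h1 - h2) + norm (b1 - b2) * norm (\<eta>1 - \<eta>2)"
    using norm_cauchy_schwarz[of ?z "h1 - h2"] norm_cauchy_schwarz[of "b1 - b2" "\<eta>1 - \<eta>2"]
      subdifferential_monotone[OF \<eta>] by linarith
  also have "\<dots> \<le> norm ?z * norm (h1 - h2) + norm (b1 - b2) * (norm \<eta>1 + norm \<eta>2)"
    by (intro add_left_mono mult_left_mono norm_triangle_ineq4) simp
  finally show ?thesis .
qed

section \<open>Continuous dependence on the data\<close>

lemma integrable_norm_diff_of_square_integrable:
  assumes "square_integrable_on T h1" and "square_integrable_on T h2"
  shows "integrable (lebesgue_on {0..T}) (\<lambda>t. norm (h1 t - h2 t))"
proof (rule Bochner_Integration.integrable_bound)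
  have "integrable (lebesgue_on {0..T}) (\<lambda>t. 2 :: real)"
    by (rule continuous_imp_integrable_real) simp
  then show "integrable (lebesgue_on {0..T}) (\<lambda>t. 2 + (norm (h1 t))\<^sup>2 + (norm (h2 t))\<^sup>2)"
    using assms by (intro Bochner_Integration.integrable_add) (auto simp: square_integrable_on_def)
  show "(\<lambda>t. norm (h1 t - h2 t)) \<in> borel_measurable (lebesgue_on {0..T})"
    using assms by (auto simp: square_integrable_on_def intro!: borel_measurable_norm borel_measurable_diff)
  have le: "norm v \<le> 1 + (norm v)\<^sup>2" for v :: 'a
    using zero_le_power2[of "norm v - 1 / 2"] by (simp add: power2_eq_square algebra_simps)
  show "AE t in lebesgue_on {0..T}.
      norm (norm (h1 t - h2 t)) \<le> norm (2 + (norm (h1 t))\<^sup>2 + (norm (h2 t))\<^sup>2)"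
  proof (rule AE_I2)
    fix t
    have "norm (h1 t - h2 t) \<le> 2 + (norm (h1 t))\<^sup>2 + (norm (h2 t))\<^sup>2"
      using norm_triangle_ineq4[of "h1 t" "h2 t"] le[of "h1 t"] le[of "h2 t"] by linarith
    then show "norm (norm (h1 t - h2 t)) \<le> norm (2 + (norm (h1 t))\<^sup>2 + (norm (h2 t))\<^sup>2)"
      by simp
  qed
qed

lemma bdd_above_norm_pow:
  assumes "continuous_on S x" and "compact S" and "1 \<le> p"
  shows "bdd_above ((\<lambda>t. norm_pow p (x t)) ` S)"
proof -
  have "compact (x ` S)" by (rule compact_continuous_image[OF assms(1,2)])
  then obtain B where "0 < B" and B: "\<And>t. t \<in> S \<Longrightarrow> norm (x t) \<le> B"
    using compact_imp_bounded[of "x ` S"] by (auto simp: bounded_pos)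
  show ?thesis
  proof (rule bdd_aboveI2)
    fix t assume "t \<in> S"
    then have "norm (x t) powr ((p - 1) / 2) \<le> B powr ((p - 1) / 2)"
      using B \<open>1 \<le> p\<close> by (intro powr_mono2) auto
    \<comment> \<open>The summand 1 accounts for \<open>p = 1\<close>.\<close>
    then show "norm_pow p (x t) \<le> 1 + B powr ((p - 1) / 2)"
      by (simp add: norm_pow_def add_increasing)
  qed
qed

theorem theorem4p1:
  fixes E :: "('n::finite + 'm::finite) set set"
    and w :: "('n + 'm) set \<Rightarrow> real"
    and p :: real
  assumes "hypergraph E w" and "hypergraph_connected E" and "1 \<le> p"
  shows "\<exists>\<gamma>::real. \<forall>(T::real) (a1 :: real \<Rightarrow> real ^ ('n + 'm)) a2 h1 h2 x01 x02 x1 x2.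
    0 < T \<longrightarrow>
    admissible_boundary T a1 \<longrightarrow> admissible_boundary T a2 \<longrightarrow>
    square_integrable_on T h1 \<longrightarrow> square_integrable_on T h2 \<longrightarrow>
    x01 \<in> constraint_set (a1 0) \<longrightarrow> x02 \<in> constraint_set (a2 0) \<longrightarrow>
    is_solution p E w T a1 h1 x01 x1 \<longrightarrow> is_solution p E w T a2 h2 x02 x2 \<longrightarrow>
    (SUP t\<in>{0..T}. sqrt (\<Sum>i\<in>UNIV. \<bar>x1 t $ Inl i - x2 t $ Inl i\<bar>\<^sup>2))
      \<le> sqrt (\<Sum>i\<in>UNIV. \<bar>x01 $ Inl i - x02 $ Inl i\<bar>\<^sup>2)
        + (LINT t|lebesgue_on {0..T}. norm (h1 t - h2 t))
        + \<gamma> * ((SUP t\<in>{0..T}. norm_pow p (x1 t)) + (SUP t\<in>{0..T}. norm_pow p (x2 t)))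
            * sqrt (LINT t|lebesgue_on {0..T}. norm (a1 t - a2 t))"
proof -
  define C where "C = 2 powr p * (\<Sum>e\<in>E. w e)"
  have "0 \<le> C"
    using assms(1) by (auto simp: C_def hypergraph_def intro!: mult_nonneg_nonneg sum_nonneg intro: less_imp_le)
  show ?thesis
  proof (intro exI[of _ "sqrt (2 * C)"] allI impI)
    fix T :: real and a1 a2 h1 h2 x1 x2 :: "real \<Rightarrow> real ^ ('n + 'm)" and x01 x02
    assume "0 < T" and a1: "admissible_boundary T a1" and a2: "admissible_boundary T a2"
      and h1: "square_integrable_on T h1" and h2: "square_integrable_on T h2"
      and sol1: "is_solution p E w T a1 h1 x01 x1" and sol2: "is_solution p E w T a2 h2 x02 x2"
    define M1 where "M1 = (SUP t\<in>{0..T}. norm_pow p (x1 t))"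
    define M2 where "M2 = (SUP t\<in>{0..T}. norm_pow p (x2 t))"
    have ac: "abs_continuous_on 0 T x1" "abs_continuous_on 0 T x2"
      "abs_continuous_on 0 T a1" "abs_continuous_on 0 T a2"
      using sol1 sol2 a1 a2 by (auto simp: is_solution_def admissible_boundary_def W12_def)
    note cont = ac[THEN abs_continuous_on_imp_continuous_on]
    have M: "norm_pow p (x1 t) \<le> M1" "norm_pow p (x2 t) \<le> M2" if "t \<in> {0..T}" for t
      unfolding M1_def M2_def
      using that cont(1,2) \<open>1 \<le> p\<close> by (auto intro!: cSUP_upper bdd_above_norm_pow)
    have "0 \<le> M1" "0 \<le> M2"
      using M[of 0] norm_pow_nonneg[of p "x1 0"] norm_pow_nonneg[of p "x2 0"] \<open>0 < T\<close> by auto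
    \<comment> \<open>On the prescribed coordinates the difference of the solutions is known, so only its free part
      needs to be estimated.\<close>
    define \<zeta> where "\<zeta> = (\<lambda>t. free_part (x1 t - x2 t))"
    define \<beta> where "\<beta> = (\<lambda>t. norm (a1 t - a2 t) * (C * (M1 + M2)\<^sup>2))"
    have energy_ineq: "AE t in lebesgue_on {0..T}. \<exists>\<zeta>'. (\<zeta> has_vector_derivative \<zeta>') (at t) \<and>
      \<zeta> t \<bullet> \<zeta>' \<le> norm (\<zeta> t) * norm (h1 t - h2 t) + \<beta> t"
      using sol1[unfolded is_solution_def, THEN conjunct2, THEN conjunct2]
        sol2[unfolded is_solution_def, THEN conjunct2, THEN conjunct2] AE_space
    proof eventually_elim
      case (elim t)
      then have t: "t \<in> {0..T}" by simp
      from elim(1) obtain x1' \<eta>1 \<xi>1 where 1: "(x1 has_vector_derivative x1') (at t)"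
          "\<eta>1 \<in> subdifferential (\<lambda>y. ereal (energy p E w y)) (x1 t)"
          "\<xi>1 \<in> subdifferential (convex_indicator (constraint_set (a1 t))) (x1 t)"
          "x1' + \<eta>1 + \<xi>1 = h1 t" by blast
      from elim(2) obtain x2' \<eta>2 \<xi>2 where 2: "(x2 has_vector_derivative x2') (at t)"
          "\<eta>2 \<in> subdifferential (\<lambda>y. ereal (energy p E w y)) (x2 t)"
          "\<xi>2 \<in> subdifferential (convex_indicator (constraint_set (a2 t))) (x2 t)"
          "x2' + \<eta>2 + \<xi>2 = h2 t" by blast
      have "(\<zeta> has_vector_derivative free_part (x1' - x2')) (at t)"
        unfolding \<zeta>_def
        by (rule bounded_linear.has_vector_derivative[OF bounded_linear_free_part
              has_vector_derivative_diff[OF 1(1) 2(1)]])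
      moreover have "\<zeta> t \<bullet> free_part (x1' - x2') \<le> norm (\<zeta> t) * norm (h1 t - h2 t)
          + norm (a1 t - a2 t) * (norm \<eta>1 + norm \<eta>2)"
        unfolding \<zeta>_def using a1 a2 t
        by (intro free_part_dissipation[OF 1(2) 2(2) 1(3) 2(3) 1(4) 2(4)])
          (auto simp: admissible_boundary_def)
      moreover have "norm \<eta>1 + norm \<eta>2 \<le> C * (M1 + M2)\<^sup>2"
      proof -
        have "norm \<eta>1 + norm \<eta>2 \<le> C * (norm_pow p (x1 t))\<^sup>2 + C * (norm_pow p (x2 t))\<^sup>2"
          unfolding C_def using energy_subgradient_le[OF assms(1,3)] 1(2) 2(2)
          by (intro add_mono) auto
        also have "\<dots> \<le> C * M1\<^sup>2 + C * M2\<^sup>2"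
          using M[OF t] \<open>0 \<le> C\<close> norm_pow_nonneg
          by (intro add_mono mult_left_mono power_mono) auto
        also have "\<dots> = C * (M1\<^sup>2 + M2\<^sup>2)" by (simp add: algebra_simps)
        also have "\<dots> \<le> C * (M1 + M2)\<^sup>2"
          using \<open>0 \<le> C\<close> \<open>0 \<le> M1\<close> \<open>0 \<le> M2\<close>
          by (intro mult_left_mono) (auto simp: power2_sum)
        finally show ?thesis .
      qed
      then have "norm (a1 t - a2 t) * (norm \<eta>1 + norm \<eta>2) \<le> \<beta> t"
        unfolding \<beta>_def by (intro mult_left_mono) auto
      ultimately show ?case by (intro exI[of _ "free_part (x1' - x2')"]) auto
    qed
    have \<zeta>_ac: "abs_continuous_on 0 T \<zeta>"
    proof (rule abs_continuous_on_dominated[OF ac(1,2)])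
      fix s t
      have "norm (\<zeta> t - \<zeta> s) = norm (free_part ((x1 t - x1 s) - (x2 t - x2 s)))"
        by (simp add: \<zeta>_def free_part_simps algebra_simps)
      also have "\<dots> \<le> norm (x1 t - x1 s) + norm (x2 t - x2 s)"
        using norm_free_part_le norm_triangle_ineq4 by (rule order.trans)
      finally show "norm (\<zeta> t - \<zeta> s) \<le> norm (x1 t - x1 s) + norm (x2 t - x2 s)" .
    qed
    have "norm (\<zeta> t) \<le> norm (\<zeta> 0) + (LINT t|lebesgue_on {0..T}. norm (h1 t - h2 t))
        + sqrt (2 * (LINT t|lebesgue_on {0..T}. \<beta> t))" if "t \<in> {0..T}" for t
    proof (rule norm_le_of_energy_inequality[OF \<zeta>_ac _ _ _ _ energy_ineq that])
      show "integrable (lebesgue_on {0..T}) (\<lambda>t. norm (h1 t - h2 t))"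
        by (rule integrable_norm_diff_of_square_integrable[OF h1 h2])
      show "continuous_on {0..T} \<beta>"
        unfolding \<beta>_def by (intro continuous_intros cont)
      show "0 \<le> \<beta> t" for t using \<open>0 \<le> C\<close> by (simp add: \<beta>_def)
    qed simp
    moreover have "sqrt (2 * (LINT t|lebesgue_on {0..T}. \<beta> t))
        = sqrt (2 * C) * (M1 + M2) * sqrt (LINT t|lebesgue_on {0..T}. norm (a1 t - a2 t))"
      using \<open>0 \<le> M1\<close> \<open>0 \<le> M2\<close> by (simp add: \<beta>_def real_sqrt_mult mult_ac)
    moreover have "norm (\<zeta> t) = sqrt (\<Sum>i\<in>UNIV. \<bar>x1 t $ Inl i - x2 t $ Inl i\<bar>\<^sup>2)" for t
      by (simp add: \<zeta>_def norm_free_part)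
    moreover have "x1 0 = x01" "x2 0 = x02"
      using sol1 sol2 by (auto simp: is_solution_def)
    ultimately show "(SUP t\<in>{0..T}. sqrt (\<Sum>i\<in>UNIV. \<bar>x1 t $ Inl i - x2 t $ Inl i\<bar>\<^sup>2))
      \<le> sqrt (\<Sum>i\<in>UNIV. \<bar>x01 $ Inl i - x02 $ Inl i\<bar>\<^sup>2)
        + (LINT t|lebesgue_on {0..T}. norm (h1 t - h2 t))
        + sqrt (2 * C) * ((SUP t\<in>{0..T}. norm_pow p (x1 t)) + (SUP t\<in>{0..T}. norm_pow p (x2 t)))
            * sqrt (LINT t|lebesgue_on {0..T}. norm (a1 t - a2 t))"
      unfolding M1_def[symmetric] M2_def[symmetric] using \<open>0 < T\<close>
      by (intro cSUP_least) auto
  qed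
qed

end
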